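(* For any graph $G$, $$1+\frac{2m}{2m-n\delta_n}\le \chi_v(G),$$ where $n$ is the number of vertices of $G$, $m$ is the number of edges of $G$, $\delta_n$ is the smallest eigenvalue of the signless Laplacian $Q$ of $G$, and $\chi_v(G)$ is the vector chromatic number of $G$.
   Context: For a graph $G$, let $V$ denote the set of vertices with $|V|=n$, $E$ the set of edges with $|E|=m$, $A$ the adjacency matrix, and $D$ the diagonal matrix of vertex degrees. The signless Laplacian of $G$ is $Q=D+A$, with eigenvalues $\delta_1\ge\ldots\ge\delta_n$. Given a graph $G=(V,E)$ on $n$ vertices and a real number $k\ge 2$, a vector $k$-coloring of $G$ is an assignment of unit vectors $u_i\in\mathbb{R}^n$ to each vertex $i\in V$ such that for any two adjacent vertices $i$ and $j$, $\langle u_i,u_j\rangle\le -\frac{1}{k-1}$. The vector chromatic number $\chi_v(G)$ is the smallest real number $k$ for which a vector $k$-coloring exists. *)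

theory Defs
  imports "HOL-Analysis.Analysis"
begin

text \<open>
  A graph is a finite simple undirected graph whose vertex set is the finite type \<open>'v\<close>;
  hence \<open>n = CARD('v) \<ge> 1\<close>, and \<open>\<real>\<^sup>n\<close> is \<open>real ^ 'v\<close>.  Edges are two-element vertex sets.
\<close>

definition simple_graph :: "'v::finite set set \<Rightarrow> bool" where
  "simple_graph E \<longleftrightarrow> (\<forall>e\<in>E. card e = 2)"

definition vertex_degree :: "'v::finite set set \<Rightarrow> 'v \<Rightarrow> nat" where
  "vertex_degree E i = card {e \<in> E. i \<in> e}"

definition adjacency_matrix :: "'v::finite set set \<Rightarrow> real ^ 'v ^ 'v" where
  "adjacency_matrix E = (\<chi> i j. if {i, j} \<in> E then 1 else 0)"

definition degree_matrix :: "'v::finite set set \<Rightarrow> real ^ 'v ^ 'v" where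
  "degree_matrix E = (\<chi> i j. if i = j then real (vertex_degree E i) else 0)"

definition signless_laplacian :: "'v::finite set set \<Rightarrow> real ^ 'v ^ 'v" where
  "signless_laplacian E = degree_matrix E + adjacency_matrix E"

definition is_eigenvalue :: "real ^ 'n ^ 'n \<Rightarrow> real \<Rightarrow> bool" where
  "is_eigenvalue M c \<longleftrightarrow> (\<exists>x. x \<noteq> 0 \<and> M *v x = c *\<^sub>R x)"

text \<open>
  Intended for symmetric matrices, whose set of real eigenvalues is finite and nonempty
  and contains all eigenvalues.
\<close>

definition least_eigenvalue :: "real ^ 'n ^ 'n \<Rightarrow> real" where
  "least_eigenvalue M = Min {c. is_eigenvalue M c}"

definition vector_coloring :: "'v::finite set set \<Rightarrow> real \<Rightarrow> ('v \<Rightarrow> real ^ 'v) \<Rightarrow> bool" where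
  "vector_coloring E k u \<longleftrightarrow>
     k \<ge> 2 \<and> (\<forall>i. norm (u i) = 1) \<and>
     (\<forall>i j. {i, j} \<in> E \<longrightarrow> u i \<bullet> u j \<le> - (1 / (k - 1)))"

text \<open>
  For a simple graph the minimum exists: the vertices of a regular simplex give a vector
  coloring for \<open>k = max 2 n\<close>, and the admissible \<open>k\<close> form a closed set because the
  unit sphere is compact.
\<close>

definition vector_chromatic_number :: "'v::finite set set \<Rightarrow> real" where
  "vector_chromatic_number E = (LEAST k. \<exists>u. vector_coloring E k u)"

end

theory Submission
  imports Defs
begin

text \<open>
  If \<open>u\<close> is a vector coloring for \<open>k\<close>, then applying the Rayleigh bound
  \<open>\<delta>\<^sub>n \<bar>x\<bar>\<^sup>2 \<le> x \<bullet> Q x\<close> to each coordinate of \<open>u\<close> and adding up yields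
  \<open>n \<delta>\<^sub>n \<le> (\<Sum>i. d\<^sub>i) + (\<Sum>i\<sim>j. u\<^sub>i \<bullet> u\<^sub>j) \<le> 2 m - 2 m / (k - 1)\<close>.
  It remains to know that \<open>\<delta>\<^sub>n\<close> is the minimum of the Rayleigh quotient and that the least
  \<open>k\<close> is attained; both follow by compactness.
\<close>

section \<open>The least eigenvalue of a symmetric matrix\<close>

lemma symmetric_matrix_inner:
  fixes M :: "real ^ 'n ^ 'n"
  assumes "transpose M = M"
  shows "(M *v x) \<bullet> y = x \<bullet> (M *v y)"
  by (metis assms dot_lmul_matrix transpose_matrix_vector)

lemma eigenvectors_orthogonal:
  fixes M :: "real ^ 'n ^ 'n"
  assumes "transpose M = M" "M *v x = c *\<^sub>R x" "M *v y = d *\<^sub>R y" "c \<noteq> d"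
  shows "x \<bullet> y = 0"
proof -
  have "c * (x \<bullet> y) = d * (x \<bullet> y)"
    using symmetric_matrix_inner[OF assms(1), of x y] assms(2,3) by simp
  then show ?thesis using assms(4) by simp
qed

text \<open>One eigenvector per eigenvalue gives an orthogonal family of nonzero vectors, which is
  independent and so finite in finite dimension. Finiteness is what lets \<open>Min\<close> in
  \<open>least_eigenvalue\<close> bound its members from below.\<close>

lemma finite_eigenvalues_symmetric:
  fixes M :: "real ^ 'n ^ 'n"
  assumes sym: "transpose M = M"
  shows "finite {c. is_eigenvalue M c}"
proof -
  define f where "f c = (SOME x. x \<noteq> 0 \<and> M *v x = c *\<^sub>R x)" for c
  have f: "f c \<noteq> 0 \<and> M *v f c = c *\<^sub>R f c" if "is_eigenvalue M c" for c
    using that unfolding is_eigenvalue_def f_def by (rule someI_ex)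
  let ?S = "{c. is_eigenvalue M c}"
  have inj: "inj_on f ?S"
  proof (rule inj_onI)
    fix c d assume "c \<in> ?S" "d \<in> ?S" "f c = f d"
    then have "c *\<^sub>R f c = d *\<^sub>R f c" "f c \<noteq> 0" using f by (metis mem_Collect_eq)+
    then show "c = d" by simp
  qed
  have "pairwise orthogonal (f ` ?S)"
    unfolding pairwise_def orthogonal_def
    using eigenvectors_orthogonal[OF sym] f by (smt (verit) image_iff mem_Collect_eq)
  then have "independent (f ` ?S)"
    by (rule pairwise_orthogonal_independent) (use f in force)
  then show ?thesis
    using inj finite_imageD independent_bound by blast
qed

text \<open>The form \<open>z \<bullet> (M *v z) - \<mu> * (z \<bullet> z)\<close> is nonnegative
  and vanishes at \<open>x\<close>. Were its gradient at \<open>x\<close> nonzero, a small step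
  against it would make the form negative.\<close>

lemma rayleigh_minimizer_eigenvector:
  fixes M :: "real ^ 'n ^ 'n"
  assumes sym: "transpose M = M"
    and ge: "\<And>x. \<mu> * (x \<bullet> x) \<le> x \<bullet> (M *v x)"
    and eq: "x \<bullet> (M *v x) = \<mu> * (x \<bullet> x)"
  shows "M *v x = \<mu> *\<^sub>R x"
proof (rule ccontr)
  assume neq: "M *v x \<noteq> \<mu> *\<^sub>R x"
  \<comment> \<open>By symmetry, \<open>y\<close> is half the gradient of the form at
    \<open>x\<close>, and \<open>b\<close> is the value of the form at \<open>y\<close>.\<close>
  define y where "y = M *v x - \<mu> *\<^sub>R x"
  define a where "a = y \<bullet> y"
  define b where "b = y \<bullet> (M *v y) - \<mu> * (y \<bullet> y)"
  \<comment> \<open>The form at \<open>x - t *\<^sub>R y\<close> is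
    \<open>t\<^sup>2 * b - 2 * t * a\<close>. Its minimizer \<open>a / b\<close> fails for
    \<open>b = 0\<close>; adding 1 to the denominator avoids this and still gives
    \<open>t * b \<le> a\<close>.\<close>
  define t where "t = a / (b + 1)"
  have a: "a > 0" using neq by (simp add: a_def y_def)
  have b: "b \<ge> 0" using ge[of y] by (simp add: b_def)
  have xy: "x \<bullet> (M *v y) = (M *v x) \<bullet> y" by (simp add: symmetric_matrix_inner[OF sym])
  have a_eq: "y \<bullet> (M *v x) = a + \<mu> * (x \<bullet> y)"
    unfolding a_def by (subst (2) y_def) (simp add: inner_diff_right inner_commute)
  have "(x - t *\<^sub>R y) \<bullet> (M *v (x - t *\<^sub>R y))
      - \<mu> * ((x - t *\<^sub>R y) \<bullet> (x - t *\<^sub>R y)) = t\<^sup>2 * b - 2 * t * a"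
    using eq xy unfolding b_def
    by (simp add: a_eq matrix_vector_mult_diff_distrib matrix_vector_mult_scaleR inner_diff_left
        inner_diff_right inner_commute algebra_simps power2_eq_square)
  moreover have "\<mu> * ((x - t *\<^sub>R y) \<bullet> (x - t *\<^sub>R y)) \<le> (x - t *\<^sub>R y) \<bullet> (M *v (x - t *\<^sub>R y))"
    by (rule ge)
  ultimately have "0 \<le> t * (t * b - 2 * a)"
    by (simp add: algebra_simps power2_eq_square)
  moreover have "t > 0" using a b by (simp add: t_def)
  moreover have "t * b \<le> a" using a b by (simp add: t_def field_simps)
  ultimately show False using a by (simp add: zero_le_mult_iff)
qed

text \<open>The quadratic form attains its minimum on the compact unit sphere; homogeneity of degree
  two carries the bound to all vectors.\<close>

lemma rayleigh_minimum_exists: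
  fixes M :: "real ^ 'n ^ 'n"
  obtains \<mu> x where "x \<noteq> 0" "x \<bullet> (M *v x) = \<mu> * (x \<bullet> x)"
    "\<And>y. \<mu> * (y \<bullet> y) \<le> y \<bullet> (M *v y)"
proof -
  have "compact (sphere (0 :: real ^ 'n) 1)" "sphere (0 :: real ^ 'n) 1 \<noteq> {}"
    by simp_all
  moreover have "continuous_on (sphere 0 1) (\<lambda>x. x \<bullet> (M *v x))"
    by (intro continuous_intros linear_continuous_on matrix_vector_mul_bounded_linear)
  ultimately obtain x where x: "x \<in> sphere 0 1"
    and min: "\<And>y. y \<in> sphere 0 1 \<Longrightarrow> x \<bullet> (M *v x) \<le> y \<bullet> (M *v y)"
    using continuous_attains_inf by metis
  have "x \<bullet> x = 1" using x by (simp add: norm_eq_1)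
  moreover have "(x \<bullet> (M *v x)) * (y \<bullet> y) \<le> y \<bullet> (M *v y)" for y
  proof (cases "y = 0")
    case False
    have "x \<bullet> (M *v x) \<le> (y /\<^sub>R norm y) \<bullet> (M *v (y /\<^sub>R norm y))"
      using False by (intro min) simp
    also have "\<dots> = (y \<bullet> (M *v y)) / (y \<bullet> y)"
      by (simp add: matrix_vector_mult_scaleR dot_square_norm power2_eq_square field_simps)
    finally show ?thesis using False by (simp add: pos_le_divide_eq)
  qed simp
  ultimately show ?thesis using that[of x "x \<bullet> (M *v x)"] by force
qed

text \<open>The minimum of the Rayleigh quotient is itself an eigenvalue, hence at least the
  smallest one.\<close>

lemma least_eigenvalue_le_rayleigh:
  fixes M :: "real ^ 'n ^ 'n"
  assumes sym: "transpose M = M"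
  shows "least_eigenvalue M * (x \<bullet> x) \<le> x \<bullet> (M *v x)"
proof -
  obtain \<mu> z where z: "z \<noteq> 0" "z \<bullet> (M *v z) = \<mu> * (z \<bullet> z)"
    and ge: "\<And>y. \<mu> * (y \<bullet> y) \<le> y \<bullet> (M *v y)"
    using rayleigh_minimum_exists by metis
  have "is_eigenvalue M \<mu>"
    using rayleigh_minimizer_eigenvector[OF sym ge z(2)] z(1) by (auto simp: is_eigenvalue_def)
  then have "least_eigenvalue M \<le> \<mu>"
    unfolding least_eigenvalue_def using finite_eigenvalues_symmetric[OF sym] by simp
  then show ?thesis using ge[of x] mult_right_mono[of _ \<mu> "x \<bullet> x"] by fastforce
qed

lemma least_eigenvalue_le_gram:
  fixes M :: "real ^ 'n ^ 'n" and u :: "'n \<Rightarrow> real ^ 'm"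
  assumes sym: "transpose M = M"
  shows "least_eigenvalue M * (\<Sum>i\<in>UNIV. u i \<bullet> u i)
    \<le> (\<Sum>i\<in>UNIV. \<Sum>j\<in>UNIV. M $ i $ j * (u i \<bullet> u j))"
proof -
  \<comment> \<open>The Gram sum splits over coordinates: \<open>x c\<close> is row \<open>c\<close>
    of the matrix whose columns are the \<open>u i\<close>, and the Rayleigh bound applies to each
    row.\<close>
  define x where "x c = (\<chi> i. u i $ c)" for c
  have "(\<Sum>i\<in>UNIV. u i \<bullet> u i) = (\<Sum>c\<in>UNIV. x c \<bullet> x c)"
    unfolding inner_vec_def x_def by (simp, rule sum.swap)
  then have "least_eigenvalue M * (\<Sum>i\<in>UNIV. u i \<bullet> u i)
      \<le> (\<Sum>c\<in>UNIV. x c \<bullet> (M *v x c))"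
    by (simp add: sum_distrib_left sum_mono least_eigenvalue_le_rayleigh[OF sym])
  also have "\<dots> = (\<Sum>c\<in>UNIV. \<Sum>i\<in>UNIV. \<Sum>j\<in>UNIV. M $ i $ j * (u i $ c * u j $ c))"
    by (simp add: x_def inner_vec_def matrix_vector_mult_def sum_distrib_left mult_ac)
  also have "\<dots> = (\<Sum>i\<in>UNIV. \<Sum>c\<in>UNIV. \<Sum>j\<in>UNIV. M $ i $ j * (u i $ c * u j $ c))"
    by (rule sum.swap)
  also have "\<dots> = (\<Sum>i\<in>UNIV. \<Sum>j\<in>UNIV. \<Sum>c\<in>UNIV. M $ i $ j * (u i $ c * u j $ c))"
    by (intro sum.cong refl sum.swap)
  also have "\<dots> = (\<Sum>i\<in>UNIV. \<Sum>j\<in>UNIV. M $ i $ j * (u i \<bullet> u j))"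
    by (simp add: inner_vec_def sum_distrib_left)
  finally show ?thesis .
qed

section \<open>Degrees and the signless Laplacian\<close>

lemma transpose_signless_laplacian: "transpose (signless_laplacian E) = signless_laplacian E"
  by (auto simp: vec_eq_iff transpose_def signless_laplacian_def degree_matrix_def
      adjacency_matrix_def insert_commute)

text \<open>Degrees count incident edges, while the Gram sums run over neighbors; \<open>j\<close>
  corresponds to the edge \<open>{i, j}\<close>.\<close>

lemma vertex_degree_eq_card_neighbors:
  assumes "simple_graph E"
  shows "vertex_degree E i = card {j. {i, j} \<in> E}"
proof -
  have "bij_betw (\<lambda>j. {i, j}) {j. {i, j} \<in> E} {e \<in> E. i \<in> e}"
  proof (rule bij_betwI')
    fix e assume e: "e \<in> {e \<in> E. i \<in> e}"
    then have "card e = 2" using assms by (auto simp: simple_graph_def)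
    then obtain a b where "e = {a, b}" by (auto simp: card_2_iff)
    then show "\<exists>j\<in>{j. {i, j} \<in> E}. e = {i, j}" using e by (auto simp: insert_commute)
  qed (auto simp: doubleton_eq_iff)
  then show ?thesis by (simp add: vertex_degree_def bij_betw_same_card)
qed

text \<open>Double counting of incident pairs of a vertex and an edge; every edge has two
  endpoints.\<close>

lemma handshake:
  fixes E :: "'v::finite set set"
  assumes "simple_graph E"
  shows "(\<Sum>i\<in>UNIV. vertex_degree E i) = 2 * card E"
proof -
  have "(\<Sum>i\<in>UNIV. card {e \<in> E. i \<in> e}) = (\<Sum>e\<in>E. card {i \<in> UNIV. i \<in> e})"
    unfolding card_eq_sum sum.inter_filter[OF finite] sum.inter_filter[OF finite[of UNIV]]
    by (rule sum.swap)
  also have "\<dots> = 2 * card E" using assms by (simp add: simple_graph_def)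
  finally show ?thesis by (simp add: vertex_degree_def)
qed

text \<open>For unit vectors the degree matrix contributes the degree sum, and the adjacency matrix
  contributes the inner products over ordered adjacent pairs.\<close>

lemma signless_laplacian_gram:
  fixes E :: "'v::finite set set" and u :: "'v \<Rightarrow> 'a::real_inner"
  assumes G: "simple_graph E" and unit: "\<And>i. norm (u i) = 1"
  shows "(\<Sum>i\<in>UNIV. \<Sum>j\<in>UNIV. signless_laplacian E $ i $ j * (u i \<bullet> u j))
    = 2 * real (card E) + (\<Sum>i\<in>UNIV. \<Sum>j | {i, j} \<in> E. u i \<bullet> u j)"
proof -
  have "(\<Sum>j\<in>UNIV. signless_laplacian E $ i $ j * (u i \<bullet> u j))
      = real (vertex_degree E i) + (\<Sum>j | {i, j} \<in> E. u i \<bullet> u j)" for i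
  proof -
    have "signless_laplacian E $ i $ j * (u i \<bullet> u j)
        = (if i = j then real (vertex_degree E i) else 0)
          + (if {i, j} \<in> E then u i \<bullet> u j else 0)" for j
      using unit[of i]
      by (auto simp: signless_laplacian_def degree_matrix_def adjacency_matrix_def norm_eq_1
          distrib_right)
    then show ?thesis
      using sum.inter_filter[of UNIV "\<lambda>j. u i \<bullet> u j" "\<lambda>j. {i, j} \<in> E"]
      by (simp add: sum.distrib)
  qed
  then show ?thesis
    using handshake[OF G] by (simp add: sum.distrib flip: of_nat_sum)
qed

section \<open>Vector colorings\<close>

lemma vector_coloring_eigenvalue_bound:
  fixes E :: "'v::finite set set"
  assumes G: "simple_graph E" and u: "vector_coloring E k u"
  shows "real CARD('v) * least_eigenvalue (signless_laplacian E)
    \<le> 2 * real (card E) - 2 * real (card E) / (k - 1)"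
proof -
  have unit: "norm (u i) = 1" for i using u by (simp add: vector_coloring_def)
  have "real CARD('v) * least_eigenvalue (signless_laplacian E)
      = least_eigenvalue (signless_laplacian E) * (\<Sum>i\<in>UNIV. u i \<bullet> u i)"
    using unit by (simp add: norm_eq_1)
  also have "\<dots> \<le> 2 * real (card E) + (\<Sum>i\<in>UNIV. \<Sum>j | {i, j} \<in> E. u i \<bullet> u j)"
    using least_eigenvalue_le_gram[OF transpose_signless_laplacian, of E u]
    by (simp add: signless_laplacian_gram[OF G unit])
  also have "(\<Sum>i\<in>UNIV. \<Sum>j | {i, j} \<in> E. u i \<bullet> u j)
      \<le> (\<Sum>i\<in>UNIV. \<Sum>j | {i, j} \<in> E. - (1 / (k - 1)))"
    using u by (intro sum_mono) (auto simp: vector_coloring_def)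
  \<comment> \<open>The inner sum is constant, so it only counts the neighbors of
    \<open>i\<close>.\<close>
  also have "\<dots> = - (\<Sum>i\<in>UNIV. real (vertex_degree E i)) / (k - 1)"
    by (simp add: vertex_degree_eq_card_neighbors[OF G] sum_negf flip: sum_divide_distrib)
  also have "(\<Sum>i\<in>UNIV. real (vertex_degree E i)) = 2 * real (card E)"
    by (simp flip: of_nat_sum add: handshake[OF G])
  finally show ?thesis by simp
qed

text \<open>The vertices of a regular simplex serve as colors, with \<open>k = n\<close> when
  \<open>n \<ge> 2\<close>. A single vertex is treated apart: the simplex collapses to the origin,
  but there are no edges and any unit vector works with \<open>k = 2\<close>.\<close>

lemma vector_coloring_exists:
  fixes E :: "'v::finite set set"
  assumes G: "simple_graph E"
  obtains k u where "vector_coloring E k u"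
proof (cases "CARD('v) = 1")
  case True
  then have "i = j" for i j :: 'v by (metis UNIV_I card_1_singletonE singletonD)
  then have "{i, j} \<notin> E" for i j :: 'v
    using G unfolding simple_graph_def
    by (metis card_1_singleton_iff insert_absorb2 numeral_eq_one_iff One_nat_def semiring_norm(85))
  then have "vector_coloring E 2 (\<lambda>i. axis i 1)" by (simp add: vector_coloring_def)
  then show ?thesis by (rule that)
next
  case False
  define n where "n = real CARD('v)"
  have "CARD('v) \<ge> 2" using False zero_less_card_finite[where 'a='v] by linarith
  then have n: "n \<ge> 2" unfolding n_def by linarith
  \<comment> \<open>The standard basis vectors projected orthogonally to the all-ones vector:
    squared norm \<open>1 - 1 / n\<close>, mutual inner products \<open>- 1 / n\<close>, hence
    cosine \<open>- 1 / (n - 1)\<close>.\<close>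
  define w :: "'v \<Rightarrow> real ^ 'v" where "w i = axis i 1 - (1 / n) *\<^sub>R 1" for i
  have one: "(1 :: real ^ 'v) \<bullet> 1 = n" by (simp add: inner_vec_def n_def)
  have w: "w i \<bullet> w j = (if i = j then 1 else 0) - 1 / n" for i j
  proof -
    have "w i \<bullet> w j = axis i 1 \<bullet> (axis j 1 :: real ^ 'v) - 1 / n - 1 / n + 1 / n * (1 / n * n)"
      by (simp add: w_def inner_diff_left inner_diff_right inner_axis inner_axis' one algebra_simps)
    then show ?thesis using n by (simp add: inner_axis_axis)
  qed
  have norm_sq: "norm (w i) * norm (w i) = 1 - 1 / n" for i
    using w[of i i] by (simp add: dot_square_norm power2_eq_square)
  have pos: "1 - 1 / n > 0" using n by simp
  have same: "norm (w i) = norm (w j)" for i j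
    using w[of i i] w[of j j] by (simp add: norm_eq)
  have nz: "norm (w i) \<noteq> 0" for i
    using norm_sq[of i] pos by force
  have "vector_coloring E n (\<lambda>i. w i /\<^sub>R norm (w i))"
    unfolding vector_coloring_def
  proof (intro conjI allI impI)
    fix i j assume "{i, j} \<in> E"
    then have "i \<noteq> j" using G by (force simp: simple_graph_def)
    then have "(w i /\<^sub>R norm (w i)) \<bullet> (w j /\<^sub>R norm (w j)) = - (1 / n) / (norm (w i) * norm (w i))"
      using same[of j i] by (simp add: w divide_inverse)
    also have "\<dots> = - (1 / (n - 1))" unfolding norm_sq using n by (simp add: field_simps)
    finally show "(w i /\<^sub>R norm (w i)) \<bullet> (w j /\<^sub>R norm (w j)) \<le> - (1 / (n - 1))" by simp
  qed (use n nz in auto)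
  then show ?thesis by (rule that)
qed

text \<open>\<open>LEAST\<close> over the reals is informative only once a minimum is known to
  exist. It is found by minimizing \<open>k\<close> over a compact set of pairs of \<open>k\<close>
  and a coloring.\<close>

lemma vector_chromatic_number_attained:
  fixes E :: "'v::finite set set"
  assumes G: "simple_graph E"
  obtains u where "vector_coloring E (vector_chromatic_number E) u"
proof -
  obtain K u0 where u0: "vector_coloring E K u0" using vector_coloring_exists[OF G] .
  \<comment> \<open>With the denominator cleared, every condition compares continuous functions of
    \<open>k\<close> and \<open>u\<close>, so it defines a closed set. The coloring becomes an
    element of a Euclidean space.\<close>
  define P where "P k u \<longleftrightarrow> 2 \<le> k \<and> (\<forall>i. norm (u $ i) = 1) \<and>
    (\<forall>i j. {i, j} \<in> E \<longrightarrow> (k - 1) * (u $ i \<bullet> u $ j) \<le> - 1)" for k and u :: "real ^ 'v ^ 'v"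
  have P_iff: "P k u \<longleftrightarrow> vector_coloring E k (($) u)" for k u
    by (auto simp: P_def vector_coloring_def field_simps)
  \<comment> \<open>The cap \<open>K\<close>, taken from a known coloring, makes the set bounded and
    keeps it nonempty; values above \<open>K\<close> cannot be minimal.\<close>
  define S where "S = {p. fst p \<le> K \<and> P (fst p) (snd p)}"
  have "closed S"
    unfolding S_def P_def
    by (intro closed_Collect_conj closed_Collect_all closed_Collect_imp closed_Collect_le
        closed_Collect_eq open_Collect_const continuous_intros)
  moreover have "bounded S"
  proof (rule bounded_subset)
    have "norm u \<le> real CARD('v)" if "P k u" for k u
      using L2_set_le_sum[of UNIV "\<lambda>i. norm (u $ i)"] that by (simp add: P_def norm_vec_def)
    then show "S \<subseteq> {2..K} \<times> cball 0 (real CARD('v))" by (auto simp: S_def P_def)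
    show "bounded ({2..K} \<times> cball (0 :: real ^ 'v ^ 'v) (real CARD('v)))"
      by (intro bounded_Times bounded_closed_interval bounded_cball)
  qed
  ultimately have "compact S" by (simp add: compact_eq_bounded_closed)
  moreover have "(K, vec_lambda u0) \<in> S"
    using u0 by (simp add: S_def P_iff vec_lambda_inverse)
  ultimately obtain p where p: "p \<in> S" and min: "\<And>q. q \<in> S \<Longrightarrow> fst p \<le> fst q"
    using continuous_attains_inf[of S fst] continuous_on_fst[OF continuous_on_id]
    by (metis empty_iff)
  have "vector_chromatic_number E = fst p"
    unfolding vector_chromatic_number_def
  proof (rule Least_equality)
    show "\<exists>u. vector_coloring E (fst p) u" using p by (auto simp: S_def P_iff)
    fix k assume "\<exists>u. vector_coloring E k u"
    then obtain u where u: "vector_coloring E k u" ..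
    show "fst p \<le> k"
    proof (cases "k \<le> K")
      case True
      then have "(k, vec_lambda u) \<in> S" using u by (simp add: S_def P_iff vec_lambda_inverse)
      from min[OF this] show ?thesis by simp
    next
      case False
      then show ?thesis using p by (simp add: S_def)
    qed
  qed
  then show ?thesis using that p by (auto simp: S_def P_iff)
qed

theorem theorem1:
  fixes E :: "'v::finite set set"
  assumes "simple_graph E"
  shows "1 + 2 * real (card E) /
             (2 * real (card E) - real CARD('v) * least_eigenvalue (signless_laplacian E))
         \<le> vector_chromatic_number E"
proof -
  define k where "k = vector_chromatic_number E"
  define m where "m = 2 * real (card E)"
  define s where "s = m - real CARD('v) * least_eigenvalue (signless_laplacian E)"
  obtain u where u: "vector_coloring E k u"
    using vector_chromatic_number_attained[OF assms] unfolding k_def .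
  then have k: "k \<ge> 2" by (simp add: vector_coloring_def)
  have le: "m / (k - 1) \<le> s"
    using vector_coloring_eigenvalue_bound[OF assms u] by (simp add: s_def m_def)
  have "m / s \<le> k - 1"
  \<comment> \<open>Without edges the quotient is 0, whatever \<open>s\<close> is. Otherwise
    \<open>m / (k - 1) \<le> s\<close> forces \<open>s > 0\<close>, so the inequality can be
    rearranged.\<close>
  proof (cases "m = 0")
    case True
    then show ?thesis using k by simp
  next
    case False
    then have "m > 0" unfolding m_def by linarith
    then have "s > 0" using le k by (smt (verit) divide_pos_pos)
    then show ?thesis using le k by (simp add: field_simps)
  qed
  then show ?thesis by (simp add: k_def s_def m_def)
qed

end
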